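(* Consider an axis-parallel rectangle tiled by $n$ axis-parallel rectangles $R_1,\dots,R_n$, where the ratio of the vertical side length to the horizontal side length of $R_i$ equals $p_i/q_i$ with $p_i,q_i\in\mathbb{N}^+$. For each $i$ let $h_i$ and $v_i$ be the numbers of $\frac12$-shifted horizontal and $\frac12$-shifted vertical grid lines, respectively, passing through $R_i$. Suppose that (1) the top and bottom vertices of the tiled rectangle have integer $y$-coordinates; (2) no vertex of any rectangular tile has a $y$-coordinate with fractional part $\frac12$; (3) for each $i$, the ratio $h_i:v_i$ equals $p_i:q_i$ (i.e. $q_i h_i=p_i v_i$). Then each rectangle $R_i$ has horizontal side length equal to $v_i$.
   Context: The $\frac12$-shifted vertical grid lines are $\{k+\frac12\}\times\mathbb{R}$ and the $\frac12$-shifted horizontal grid lines are $\mathbb{R}\times\{k+\frac12\}$, for $k\in\mathbb{Z}$. A tiling of a region means a finite family of closed tiles with pairwise disjoint interiors whose union is the region.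
   Formalization: A shifted vertical grid line running along a vertical side of a tile is counted for the tile on its right only; counting only lines meeting the interior, or all lines meeting the closed tile, makes the claim false. If no vertical side lies on such a line, nothing changes. *)

theory Defs
  imports "HOL-Analysis.Analysis"
begin

definition axis_rect :: "real \<Rightarrow> real \<Rightarrow> real \<Rightarrow> real \<Rightarrow> (real \<times> real) set" where
  "axis_rect xl xr yb yt = {xl..xr} \<times> {yb..yt}"

definition tiling :: "'i set \<Rightarrow> ('i \<Rightarrow> (real \<times> real) set) \<Rightarrow> (real \<times> real) set \<Rightarrow> bool" where
  "tiling I R S \<longleftrightarrow> finite I \<and> (\<forall>i\<in>I. closed (R i)) \<and>
     disjoint_family_on (\<lambda>i. interior (R i)) I \<and> (\<Union>i\<in>I. R i) = S"

definition half_vertical_lines :: "(real \<times> real) set set" where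
  "half_vertical_lines = range (\<lambda>k::int. {real_of_int k + 1/2} \<times> UNIV)"

definition half_horizontal_lines :: "(real \<times> real) set set" where
  "half_horizontal_lines = range (\<lambda>k::int. UNIV \<times> {real_of_int k + 1/2})"

definition left_side :: "(real \<times> real) set \<Rightarrow> (real \<times> real) set" where
  "left_side R = {z \<in> R. \<forall>w\<in>R. fst z \<le> fst w}"

(* A line passes through R if it meets the interior of R.  A vertical line that runs along
   vertical sides is attributed to the tiles on its right; the second disjunct does this, and
   it never applies to horizontal lines.

   Some such tie-breaking is needed.  Counting only lines that meet the interior, the tiles
   [-6/5,6/5] x [0,4/5], [-6/5,0] x [4/5,2], [0,6/5] x [4/5,2], translated horizontally by 1/2,
   have (h,v) = (1,3), (1,1), (1,1), in agreement with their aspect ratios 1/3, 1, 1, although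
   their widths are 12/5, 6/5, 6/5.  Counting all lines that meet the closed tile fails in
   the same way for [-12/7,12/7] x [0,8/7], [-12/7,0] x [8/7,2], [0,12/7] x [8/7,2].
   If no vertical side lies on a shifted grid line, all these readings coincide. *)
definition passes_through :: "(real \<times> real) set \<Rightarrow> (real \<times> real) set \<Rightarrow> bool" where
  "passes_through L R \<longleftrightarrow> L \<inter> interior R \<noteq> {} \<or> left_side R \<subseteq> L"

definition num_horizontal :: "(real \<times> real) set \<Rightarrow> nat" where
  "num_horizontal R = card {L \<in> half_horizontal_lines. passes_through L R}"

definition num_vertical :: "(real \<times> real) set \<Rightarrow> nat" where
  "num_vertical R = card {L \<in> half_vertical_lines. passes_through L R}"

end

theory Submission imports Defs begin

text \<open>
  Let \<open>f x = x - \<lceil>x - 1/2\<rceil>\<close>. The width of a tile minus its number of vertical lines is the increment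
  of \<open>f\<close> over its horizontal side, and likewise for the height. The product of the increments of
  two arbitrary functions over the two sides is additive under tilings, so the products of these
  defects sum to the same product for the big rectangle, which vanishes because \<open>f\<close> is zero at
  integers. As width and number of vertical lines are scaled to height and number of horizontal
  lines by the same factor \<open>p/q\<close>, each product is \<open>p/q\<close> times a square, so every defect is zero.
\<close>

text \<open>For \<open>s\<close> at or beyond the largest point of \<open>P\<close> this is
  \<open>Min {}\<close>, an unspecified value; it is therefore evaluated only at points lying below
  some element of \<open>P\<close>.\<close>

definition next_in :: "real set \<Rightarrow> real \<Rightarrow> real" where
  "next_in P s = Min {t \<in> P. s < t}"

lemma next_in:
  assumes "finite P" "b \<in> P" "s < b"
  shows "next_in P s \<in> P" "s < next_in P s" "next_in P s \<le> b"
proof -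
  have fin: "finite {t \<in> P. s < t}" and b: "b \<in> {t \<in> P. s < t}"
    using assms by auto
  have "next_in P s \<in> {t \<in> P. s < t}"
    unfolding next_in_def using fin b by (intro Min_in) auto
  then show "next_in P s \<in> P" "s < next_in P s" by auto
  show "next_in P s \<le> b"
    unfolding next_in_def using fin b by (intro Min_le)
qed

text \<open>The sum telescopes along the consecutive points of \<open>P\<close> from
  \<open>a\<close> to \<open>b\<close>; the induction splits off the leftmost point \<open>a\<close>
  and restarts at its successor.\<close>

lemma sum_increments_next_in:
  fixes F :: "real \<Rightarrow> real"
  assumes "finite P" "a \<in> P" "b \<in> P" "a \<le> b"
  shows "(\<Sum>s | s \<in> P \<and> a \<le> s \<and> s < b. F (next_in P s) - F s) = F b - F a"
  using assms(2,4)
proof (induction "card {s \<in> P. a \<le> s \<and> s < b}" arbitrary: a rule: less_induct)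
  case less
  show ?case
  proof (cases "a = b")
    case True
    then have "{s. s \<in> P \<and> a \<le> s \<and> s < b} = {}" by auto
    then show ?thesis using True by (simp only: sum.empty)
  next
    case False
    then have "a < b" using less.prems by simp
    let ?c = "next_in P a"
    let ?A = "{s. s \<in> P \<and> ?c \<le> s \<and> s < b}"
    note c = next_in[OF \<open>finite P\<close> \<open>b \<in> P\<close> \<open>a < b\<close>]
    \<comment> \<open>No point of \<open>P\<close> lies strictly between \<open>a\<close> and its
      successor, so removing \<open>a\<close> leaves exactly the range starting at
      \<open>?c\<close>.\<close>
    have "?c \<le> s" if "s \<in> P" "a < s" for s
      using next_in(3)[OF \<open>finite P\<close> that] .
    then have split: "{s. s \<in> P \<and> a \<le> s \<and> s < b} = insert a ?A"
      using \<open>a < b\<close> less.prems c by force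
    have fin: "finite ?A" and notin: "a \<notin> ?A"
      using \<open>finite P\<close> c by auto
    have "card ?A < card {s \<in> P. a \<le> s \<and> s < b}"
      using fin notin by (simp add: split)
    then have "(\<Sum>s\<in>?A. F (next_in P s) - F s) = F b - F ?c"
      using less.hyps c by blast
    then show ?thesis
      unfolding split using fin notin by (simp del: mem_Collect_eq)
  qed
qed

lemma interior_axis_rect: "interior (axis_rect a b c d) = {a<..<b} \<times> {c<..<d}"
  by (simp add: axis_rect_def interior_Times)

text \<open>Extending all sides to full lines cuts the big rectangle into grid cells. Telescoping in
  both coordinates writes each product of increments as a sum of cell weights, and the cells of the
  tiles partition those of the big rectangle. Only values at the finitely many grid coordinates
  enter, so \<open>F\<close> and \<open>G\<close> may be arbitrary.\<close>

lemma tiling_sum_increments: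
  fixes F G :: "real \<Rightarrow> real"
  assumes ord: "X0 \<le> X1" "Y0 \<le> Y1" "\<And>i. i \<in> I \<Longrightarrow> xl i \<le> xr i \<and> yb i \<le> yt i"
    and til: "tiling I (\<lambda>i. axis_rect (xl i) (xr i) (yb i) (yt i)) (axis_rect X0 X1 Y0 Y1)"
  shows "(\<Sum>i\<in>I. (F (xr i) - F (xl i)) * (G (yt i) - G (yb i))) = (F X1 - F X0) * (G Y1 - G Y0)"
proof -
  have fin: "finite I" using til by (simp add: tiling_def)
  define PX where "PX = {X0, X1} \<union> xl ` I \<union> xr ` I"
  define PY where "PY = {Y0, Y1} \<union> yb ` I \<union> yt ` I"
  \<comment> \<open>A cell is represented by its lower left corner; the strict upper bounds leave
    out corners whose cells would start on the right or top side.\<close>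
  define cells where
    "cells a b c d = {s \<in> PX. a \<le> s \<and> s < b} \<times> {t \<in> PY. c \<le> t \<and> t < d}" for a b c d
  define w where
    "w = (\<lambda>(s, t). (F (next_in PX s) - F s) * (G (next_in PY t) - G t))"
  have finP: "finite PX" "finite PY" using fin by (auto simp: PX_def PY_def)
  then have finC: "finite (cells a b c d)" for a b c d by (simp add: cells_def)
  have sumw: "sum w (cells a b c d) = (F b - F a) * (G d - G c)"
    if "a \<in> PX" "b \<in> PX" "a \<le> b" "c \<in> PY" "d \<in> PY" "c \<le> d" for a b c d
  proof -
    have "(\<Sum>s | s \<in> PX \<and> a \<le> s \<and> s < b. F (next_in PX s) - F s) *
        (\<Sum>t | t \<in> PY \<and> c \<le> t \<and> t < d. G (next_in PY t) - G t)
      = (\<Sum>s | s \<in> PX \<and> a \<le> s \<and> s < b. \<Sum>t | t \<in> PY \<and> c \<le> t \<and> t < d.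
          (F (next_in PX s) - F s) * (G (next_in PY t) - G t))"
      by (rule sum_product)
    also have "\<dots> = sum w (cells a b c d)"
      unfolding cells_def w_def by (rule sum.cartesian_product)
    finally show ?thesis
      unfolding sum_increments_next_in[OF finP(1) that(1-3)]
        sum_increments_next_in[OF finP(2) that(4-6)] by (rule sym)
  qed
  \<comment> \<open>Grid cells are compared with tiles through their midpoints, which avoid all tile boundaries.\<close>
  define mid where "mid P s = (s + next_in P s) / 2" for P s
  have mid_gt: "s < mid P s \<and> mid P s < b" if "finite P" "b \<in> P" "s < b" for P s b
    using next_in[OF that] by (simp add: mid_def)
  have mid_ge: "a \<le> s" if "finite P" "a \<in> P" "a \<le> mid P s" for P s a
    using mid_gt[of P a s] that by (meson not_less)
  have mem: "xl i \<in> PX" "xr i \<in> PX" "yb i \<in> PY" "yt i \<in> PY" if "i \<in> I" for i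
    using that by (auto simp: PX_def PY_def)
  have mem0: "X0 \<in> PX" "X1 \<in> PX" "Y0 \<in> PY" "Y1 \<in> PY"
    by (auto simp: PX_def PY_def)
  have inner: "(mid PX s, mid PY t) \<in> interior (axis_rect a b c d)"
    if "(s, t) \<in> cells a b c d" "b \<in> PX" "d \<in> PY" for s t a b c d
    using that mid_gt[OF finP(1), of b s] mid_gt[OF finP(2), of d t]
    by (auto simp: interior_axis_rect cells_def)
  \<comment> \<open>Near-converse of \<open>inner\<close>: a closed rectangle containing the
    midpoint of a cell contains the cell. The bounds by \<open>X1\<close> and \<open>Y1\<close>
    ensure that \<open>s\<close> and \<open>t\<close> have successors.\<close>
  have outer: "(s, t) \<in> cells a b c d"
    if "(mid PX s, mid PY t) \<in> axis_rect a b c d" "s \<in> PX" "t \<in> PY" "s < X1" "t < Y1"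
      "a \<in> PX" "c \<in> PY" for s t a b c d
    using that mid_ge[OF finP(1), of a s] mid_ge[OF finP(2), of c t]
      mid_gt[OF finP(1) mem0(2), of s] mid_gt[OF finP(2) mem0(4), of t]
    by (auto simp: axis_rect_def cells_def)
  let ?C = "\<lambda>i. cells (xl i) (xr i) (yb i) (yt i)"
  let ?R = "\<lambda>i. axis_rect (xl i) (xr i) (yb i) (yt i)"
  have disj: "?C i \<inter> ?C j = {}" if "i \<in> I" "j \<in> I" "i \<noteq> j" for i j
  proof -
    have "interior (?R i) \<inter> interior (?R j) = {}"
      using til that by (auto simp: tiling_def disjoint_family_on_def)
    moreover have "(mid PX s, mid PY t) \<in> interior (?R i) \<inter> interior (?R j)"
      if st: "(s, t) \<in> ?C i" "(s, t) \<in> ?C j" for s t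
      using inner[OF st(1) mem(2,4)[OF \<open>i \<in> I\<close>]] inner[OF st(2) mem(2,4)[OF \<open>j \<in> I\<close>]]
      by (rule IntI)
    ultimately have "(s, t) \<notin> ?C i \<inter> ?C j" for s t by blast
    then show ?thesis by (simp only: disjoint_iff split_paired_All) blast
  qed
  have union: "(\<Union>i\<in>I. ?C i) = cells X0 X1 Y0 Y1"
  proof (intro equalityI subsetI)
    fix z assume "z \<in> (\<Union>i\<in>I. ?C i)"
    then obtain i s t where i: "i \<in> I" and z: "z = (s, t)" "(s, t) \<in> ?C i"
      by (cases z) blast
    have sub: "?R i \<subseteq> axis_rect X0 X1 Y0 Y1"
      using til i by (auto simp: tiling_def)
    \<comment> \<open>The upper right corner of the tile is brought in for strictness:
      \<open>s < xr i \<le> X1\<close>, and likewise for \<open>t\<close>.\<close>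
    have "(s, t) \<in> ?R i" "(xr i, yt i) \<in> ?R i"
      using z ord(3)[OF i] by (auto simp: cells_def axis_rect_def)
    then have "(s, t) \<in> axis_rect X0 X1 Y0 Y1" "(xr i, yt i) \<in> axis_rect X0 X1 Y0 Y1"
      using sub by auto
    then show "z \<in> cells X0 X1 Y0 Y1"
      using z by (auto simp: cells_def axis_rect_def)
  next
    fix z assume "z \<in> cells X0 X1 Y0 Y1"
    then obtain s t where z: "z = (s, t)" "(s, t) \<in> cells X0 X1 Y0 Y1"
      by (cases z) blast
    then have st: "s \<in> PX" "t \<in> PY" "s < X1" "t < Y1"
      by (auto simp: cells_def)
    have "(mid PX s, mid PY t) \<in> axis_rect X0 X1 Y0 Y1"
      using inner[OF z(2) mem0(2,4)] interior_subset by blast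
    then obtain i where i: "i \<in> I" "(mid PX s, mid PY t) \<in> ?R i"
      using til by (auto simp: tiling_def)
    have "(s, t) \<in> ?C i"
      using outer[OF i(2) st] mem[OF i(1)] by simp
    then show "z \<in> (\<Union>i\<in>I. ?C i)" using i z by blast
  qed
  have "(\<Sum>i\<in>I. (F (xr i) - F (xl i)) * (G (yt i) - G (yb i))) = (\<Sum>i\<in>I. sum w (?C i))"
    using ord mem by (intro sum.cong refl sumw[symmetric]) auto
  also have "\<dots> = sum w (\<Union>i\<in>I. ?C i)"
    using fin finC disj by (intro sum.UNION_disjoint[symmetric]) auto
  also have "\<dots> = (F X1 - F X0) * (G Y1 - G Y0)"
    unfolding union using ord mem0 by (intro sumw) auto
  finally show ?thesis .
qed

text \<open>The half-open interval makes the count an increment of a single function of the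
  endpoint, as the additivity lemma requires.\<close>

lemma card_half_integers_atLeastLessThan:
  assumes "a \<le> b"
  shows "real (card {k::int. a \<le> of_int k + 1/2 \<and> of_int k + 1/2 < b})
    = of_int \<lceil>b - 1/2\<rceil> - of_int \<lceil>a - 1/2\<rceil>"
proof -
  have "{k::int. a \<le> of_int k + 1/2 \<and> of_int k + 1/2 < b} = {\<lceil>a - 1/2\<rceil>..<\<lceil>b - 1/2\<rceil>}"
    by (auto simp: ceiling_le_iff less_ceiling_iff algebra_simps)
  moreover have "\<lceil>a - 1/2\<rceil> \<le> \<lceil>b - 1/2\<rceil>"
    using assms by (intro ceiling_mono) simp
  ultimately show ?thesis by simp
qed

lemma left_side_axis_rect:
  assumes "a \<le> b" "c \<le> d"
  shows "left_side (axis_rect a b c d) = {a} \<times> {c..d}"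
  using assms by (auto simp: left_side_def axis_rect_def intro: antisym)

text \<open>The interior contributes the lines with abscissa in the open interval from
  \<open>a\<close> to \<open>b\<close>, and the \<open>left_side\<close> clause adds the endpoint
  \<open>a\<close>.\<close>

lemma num_vertical_axis_rect:
  assumes "a < b" "c < d"
  shows "real (num_vertical (axis_rect a b c d)) = of_int \<lceil>b - 1/2\<rceil> - of_int \<lceil>a - 1/2\<rceil>"
proof -
  let ?L = "\<lambda>k::int. {real_of_int k + 1/2} \<times> (UNIV :: real set)"
  have "inj ?L" by (rule injI) (drule arg_cong[of _ _ "image fst"], simp)
  have "passes_through (?L k) (axis_rect a b c d) \<longleftrightarrow> a \<le> of_int k + 1/2 \<and> of_int k + 1/2 < b" for k
    using assms
    by (auto simp: passes_through_def interior_axis_rect left_side_axis_rect Times_Int_Times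
        times_subset_iff times_eq_iff)
  then have "{L \<in> half_vertical_lines. passes_through L (axis_rect a b c d)}
      = ?L ` {k. a \<le> of_int k + 1/2 \<and> of_int k + 1/2 < b}"
    by (auto simp: half_vertical_lines_def)
  then have "num_vertical (axis_rect a b c d) = card {k::int. a \<le> of_int k + 1/2 \<and> of_int k + 1/2 < b}"
    unfolding num_vertical_def
    by (simp add: card_image inj_on_subset[OF \<open>inj ?L\<close>])
  then show ?thesis
    using card_half_integers_atLeastLessThan[of a b] assms by simp
qed

text \<open>A nondegenerate vertical side never fits into a horizontal line, so only the open
  interval from \<open>c\<close> to \<open>d\<close> counts. As \<open>c\<close> is not a
  half-integer, it can be closed at \<open>c\<close> without changing the count.\<close>

lemma num_horizontal_axis_rect:
  assumes "a < b" "c < d" "frac c \<noteq> 1/2"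
  shows "real (num_horizontal (axis_rect a b c d)) = of_int \<lceil>d - 1/2\<rceil> - of_int \<lceil>c - 1/2\<rceil>"
proof -
  let ?L = "\<lambda>k::int. (UNIV :: real set) \<times> {real_of_int k + 1/2}"
  have "inj ?L" by (rule injI) (drule arg_cong[of _ _ "image snd"], simp)
  have "c \<noteq> of_int k + 1/2" for k :: int
    using assms(3) by (auto simp: frac_unique_iff)
  then have open_iff: "c < of_int k + 1/2 \<longleftrightarrow> c \<le> of_int k + 1/2" for k :: int
    by (simp add: order.strict_iff_order)
  have "passes_through (?L k) (axis_rect a b c d) \<longleftrightarrow> c < of_int k + 1/2 \<and> of_int k + 1/2 < d" for k
    using assms(1,2)
    by (auto simp: passes_through_def interior_axis_rect left_side_axis_rect Times_Int_Times
        times_subset_iff times_eq_iff subset_singleton_iff atLeastAtMost_singleton_iff)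
  then have "{L \<in> half_horizontal_lines. passes_through L (axis_rect a b c d)}
      = ?L ` {k. c \<le> of_int k + 1/2 \<and> of_int k + 1/2 < d}"
    unfolding open_iff by (auto simp: half_horizontal_lines_def)
  then have "num_horizontal (axis_rect a b c d) = card {k::int. c \<le> of_int k + 1/2 \<and> of_int k + 1/2 < d}"
    unfolding num_horizontal_def
    by (simp add: card_image inj_on_subset[OF \<open>inj ?L\<close>])
  then show ?thesis
    using card_half_integers_atLeastLessThan[of c d] assms by simp
qed

lemma ceiling_minus_half_of_Ints:
  fixes x :: real
  assumes "x \<in> \<int>"
  shows "of_int \<lceil>x - 1/2\<rceil> = x"
proof -
  obtain k where "x = of_int k" using assms by (auto elim: Ints_cases)
  moreover have "\<lceil>real_of_int k - 1/2\<rceil> = k" by (rule ceiling_unique) auto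
  ultimately show ?thesis by simp
qed

theorem theorem5p1:
  fixes X0 X1 Y0 Y1 :: real
    and n :: nat
    and xl xr yb yt :: "nat \<Rightarrow> real"
    and R :: "nat \<Rightarrow> (real \<times> real) set"
    and p q h v :: "nat \<Rightarrow> nat"
  assumes "X0 < X1" and "Y0 < Y1"
    and "\<And>i. i \<in> {1..n} \<Longrightarrow> xl i < xr i \<and> yb i < yt i"
    and "\<And>i. i \<in> {1..n} \<Longrightarrow> R i = axis_rect (xl i) (xr i) (yb i) (yt i)"
    and "tiling {1..n} R (axis_rect X0 X1 Y0 Y1)"
    and "\<And>i. i \<in> {1..n} \<Longrightarrow> p i > 0 \<and> q i > 0"
    and "\<And>i. i \<in> {1..n} \<Longrightarrow> (yt i - yb i) / (xr i - xl i) = real (p i) / real (q i)"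
    and "\<And>i. i \<in> {1..n} \<Longrightarrow> h i = num_horizontal (R i)"
    and "\<And>i. i \<in> {1..n} \<Longrightarrow> v i = num_vertical (R i)"
    and "Y0 \<in> \<int>" and "Y1 \<in> \<int>"
    and "\<And>i. i \<in> {1..n} \<Longrightarrow> frac (yb i) \<noteq> 1/2 \<and> frac (yt i) \<noteq> 1/2"
    and "\<And>i. i \<in> {1..n} \<Longrightarrow> q i * h i = p i * v i"
  shows "\<forall>i\<in>{1..n}. xr i - xl i = real (v i)"
proof
  note ord = assms(3) and R = assms(4) and pq = assms(6) and ratio = assms(7)
  define f where "f x = x - of_int \<lceil>x - 1/2\<rceil>" for x :: real
  define e where "e i = xr i - xl i - real (v i)" for i
  define r where "r i = real (p i) / real (q i)" for i
  have vert: "f (xr i) - f (xl i) = e i" if "i \<in> {1..n}" for i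
    using num_vertical_axis_rect[of "xl i" "xr i" "yb i" "yt i"] ord[OF that] assms(9)[OF that]
    by (simp add: R[OF that] f_def e_def)
  have horiz: "f (yt i) - f (yb i) = r i * e i" if i: "i \<in> {1..n}" for i
  proof -
    have "f (yt i) - f (yb i) = (yt i - yb i) - real (h i)"
      using num_horizontal_axis_rect[of "xl i" "xr i" "yb i" "yt i"] ord[OF i] assms(8)[OF i]
        assms(12)[OF i]
      by (simp add: R[OF i] f_def)
    moreover have "yt i - yb i = r i * (xr i - xl i)"
      using ratio[OF i] ord[OF i] by (simp add: r_def field_simps)
    moreover have "real (h i) = r i * real (v i)"
    proof -
      have "real (q i) * real (h i) = real (p i) * real (v i)"
        using assms(13)[OF i] by (metis of_nat_mult)
      then show ?thesis using pq[OF i] by (simp add: r_def field_simps)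
    qed
    ultimately show ?thesis by (simp add: e_def algebra_simps)
  qed
  have "tiling {1..n} (\<lambda>i. axis_rect (xl i) (xr i) (yb i) (yt i)) (axis_rect X0 X1 Y0 Y1)"
    using assms(5) R by (simp add: tiling_def disjoint_family_on_def)
  then have "(\<Sum>i\<in>{1..n}. (f (xr i) - f (xl i)) * (f (yt i) - f (yb i))) = (f X1 - f X0) * (f Y1 - f Y0)"
    using assms(1,2) ord by (intro tiling_sum_increments) (auto simp: less_imp_le)
  \<comment> \<open>The vertical factor of the big rectangle is thus zero, which kills the product
    whatever \<open>f X1 - f X0\<close> is.\<close>
  moreover have "f Y0 = 0" "f Y1 = 0"
    using assms(10,11) by (simp_all add: f_def ceiling_minus_half_of_Ints)
  ultimately have "(\<Sum>i\<in>{1..n}. r i * (e i)\<^sup>2) = 0"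
    by (simp add: vert horiz power2_eq_square mult.left_commute)
  then have zero: "\<forall>i\<in>{1..n}. r i * (e i)\<^sup>2 = 0"
    by (subst (asm) sum_nonneg_eq_0_iff) (auto simp: r_def)
  fix i assume i: "i \<in> {1..n}"
  then have "r i * (e i)\<^sup>2 = 0" using zero by blast
  \<comment> \<open>Positivity of \<open>p i\<close> and \<open>q i\<close> makes the factor
    \<open>r i\<close> nonzero, so the square must vanish.\<close>
  then have "e i = 0" using pq[OF i] by (simp add: r_def)
  then show "xr i - xl i = real (v i)" by (simp add: e_def)
qed

end
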